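(* Assume (G1) and (G2). Then for every $\eta>0$, $$\frac{d}{dt}\int_\Omega\frac{1}{\gamma(\Theta)+D}v_x^2+\frac{2\gamma(0)}{\gamma(0)+D}\int_\Omega v_{xx}^2\le(2+\eta)a\int_\Omega\frac1{\gamma(\Theta)+D}v_x^2+\frac{a^3}{\eta D}\int_\Omega u_x^2\quad\text{for all }t\in(0,T_{max}).$$
   Context: Standing setting: $\Omega\subset\mathbb{R}$ is an open bounded interval, $a>0$, $D>0$. (G1): $\gamma\in C^2([0,\infty))$ with $\gamma>0$ and $\gamma'\ge0$ on $[0,\infty)$. (G2): $D(\gamma+D)\gamma''+2\gamma\gamma'^2\le0$ on $[0,\infty)$. Initial data: $u_0\in W^{3,2}(\Omega)$, $u_{0x}=0$ on $\partial\Omega$; $u_{0t}\in W^{2,2}(\Omega)$, $(u_{0t})_x=0$ on $\partial\Omega$; $\Theta_0\in W^{2,2}(\Omega)$, $\Theta_0\ge0$, $\Theta_{0x}=0$ on $\partial\Omega$. Under (G1), there are $T_{max}\in(0,\infty]$ and a unique classical solution $(u,\Theta)$, $\Theta\ge0$, of $u_{tt}=(\gamma(\Theta)u_{xt})_x+a(\gamma(\Theta)u_x)_x$, $\Theta_t=D\Theta_{xx}+\gamma(\Theta)u_{xt}^2$ in $\Omega\times(0,T_{max})$, $u_x=\Theta_x=0$ on $\partial\Omega$, $u(\cdot,0)=u_0$, $u_t(\cdot,0)=u_{0t}$, $\Theta(\cdot,0)=\Theta_0$, with $u,u_t,\Theta\in\bigcup_{\mu\in(0,1)}C^{1+\mu,\frac{1+\mu}2}(\overline\Omega\times[0,T_{max}))\cap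 C^{2,1}(\overline\Omega\times(0,T_{max}))$, and such that if $T_{max}<\infty$ then $\limsup_{t\nearrow T_{max}}(\|u_t(\cdot,t)\|_{W^{1,2}(\Omega)}+\|\Theta(\cdot,t)\|_{L^\infty(\Omega)})=\infty$. Set $v:=u_t+au$; then $v_t=(\gamma(\Theta)v_x)_x+av-a^2u$, $u_t=v-au$, and $v_x=0$ on $\partial\Omega$. *)

theory Defs
  imports "HOL-Analysis.Analysis"
begin

text \<open>f belongs to C^{2,1}([al,be] x I): f, f_x, f_xx, f_t exist and are continuous
  on [al,be] x I; fx, fxx, ft are the respective partial derivatives
  (one-sided in x at the endpoints of [al,be]).\<close>
definition C21 :: "real \<Rightarrow> real \<Rightarrow> real set \<Rightarrow> (real \<Rightarrow> real \<Rightarrow> real) \<Rightarrow>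
    (real \<Rightarrow> real \<Rightarrow> real) \<Rightarrow> (real \<Rightarrow> real \<Rightarrow> real) \<Rightarrow> (real \<Rightarrow> real \<Rightarrow> real) \<Rightarrow> bool" where
  "C21 al be I f fx fxx ft \<longleftrightarrow>
     continuous_on ({al..be} \<times> I) (\<lambda>p. f (fst p) (snd p)) \<and>
     continuous_on ({al..be} \<times> I) (\<lambda>p. fx (fst p) (snd p)) \<and>
     continuous_on ({al..be} \<times> I) (\<lambda>p. fxx (fst p) (snd p)) \<and>
     continuous_on ({al..be} \<times> I) (\<lambda>p. ft (fst p) (snd p)) \<and>
     (\<forall>x\<in>{al..be}. \<forall>t\<in>I.
        ((\<lambda>y. f y t) has_real_derivative fx x t) (at x within {al..be}) \<and>
        ((\<lambda>y. fx y t) has_real_derivative fxx x t) (at x within {al..be}) \<and>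
        ((\<lambda>s. f x s) has_real_derivative ft x t) (at t))"

end

theory Submission
  imports Defs
begin

(* Write v = u_t + a u, kappa = gamma(Theta) + D and E(t) = int v_x^2 / kappa. Differentiating
   under the integral sign, the term 2 v_x v_xt / kappa is integrated by parts against
   v_t = u_tt + a u_t, where u_tt = (gamma(Theta) v_x)_x by the first equation; in the term
   coming from gamma(Theta)_t one inserts Theta_t = D Theta_xx + gamma(Theta) u_xt^2 and
   integrates D Theta_xx by parts once more. All boundary terms vanish by the Neumann
   conditions, and the resulting integrand is, pointwise,
     2 a u_xt v_x / kappa - 2 gamma v_xx^2 / kappa
       + Theta_x^2 v_x^2 (2 gamma gamma'^2 + D kappa gamma'') / kappa^3
       - gamma gamma' v_x^2 u_xt^2 / kappa^2.
   The third term is nonpositive by (G2) and the fourth because gamma' >= 0. Since gamma is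
   nondecreasing, gamma / kappa >= gamma(0) / (gamma(0) + D) in the second term. Finally, with
   u_xt = v_x - a u_x, Young's inequality bounds the first term by
   (2 + eta) a v_x^2 / kappa + a^3 u_x^2 / (eta D). *)

lemma DERIV_chain_within_subset:
  fixes f g :: "real \<Rightarrow> real"
  assumes "(f has_real_derivative f') (at (g x) within T)"
    and "(g has_real_derivative g') (at x within S)"
    and "g ` S \<subseteq> T"
  shows "((\<lambda>y. f (g y)) has_real_derivative f' * g') (at x within S)"
  using DERIV_image_chain[OF has_field_derivative_subset[OF assms(1,3)] assms(2)]
  by (simp add: o_def)

lemma DERIV_nonneg_imp_increasing_atLeast:
  fixes f f' :: "real \<Rightarrow> real"
  assumes deriv: "\<And>s. c \<le> s \<Longrightarrow> (f has_real_derivative f' s) (at s within {c..})"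
    and nonneg: "\<And>s. c \<le> s \<Longrightarrow> 0 \<le> f' s"
    and "c \<le> s"
  shows "f c \<le> f s"
proof (rule DERIV_nonneg_imp_increasing_open[OF \<open>c \<le> s\<close>])
  fix y assume "c < y" "y < s"
  then have "(f has_real_derivative f' y) (at y)"
    using deriv[of y] at_within_interior[of y "{c..}"] by simp
  then show "\<exists>y'. (f has_real_derivative y') (at y) \<and> 0 \<le> y'"
    using nonneg \<open>c < y\<close> by auto
next
  have "continuous_on {c..} f"
    using deriv by (intro DERIV_continuous_on) auto
  then show "continuous_on {c..s} f"
    by (rule continuous_on_subset) auto
qed

lemma integral_le_by_vanishing_flux:
  fixes f g F F' :: "real \<Rightarrow> real"
  assumes "a \<le> b"
    and flux: "\<And>x. x \<in> {a..b} \<Longrightarrow> (F has_real_derivative F' x) (at x within {a..b})"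
    and "F a = 0" "F b = 0"
    and f: "f integrable_on {a..b}" and g: "g integrable_on {a..b}"
    and le: "\<And>x. x \<in> {a<..<b} \<Longrightarrow> f x - F' x \<le> g x"
  shows "integral {a..b} f \<le> integral {a..b} g"
proof -
  have "(F' has_integral F b - F a) {a..b}"
    using flux by (intro fundamental_theorem_of_calculus[OF \<open>a \<le> b\<close>])
      (simp add: has_real_derivative_iff_has_vector_derivative)
  then have "((\<lambda>x. f x - F' x) has_integral integral {a..b} f) {a..b}"
    using has_integral_diff[OF integrable_integral[OF f]] \<open>F a = 0\<close> \<open>F b = 0\<close> by fastforce
  then have "((\<lambda>x. f x - F' x) has_integral integral {a..b} f) {a<..<b}"
    by (simp add: has_integral_Icc_iff_Ioo)
  moreover have "(g has_integral integral {a..b} g) {a<..<b}"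
    using integrable_integral[OF g] by (simp add: has_integral_Icc_iff_Ioo)
  ultimately show ?thesis
    using le by (rule has_integral_le)
qed

lemma leibniz_rule_real_derivative_open:
  fixes f ft :: "real \<Rightarrow> real \<Rightarrow> real"
  assumes U: "open U" "convex U" "t \<in> U"
    and deriv: "\<And>x s. x \<in> {a..b} \<Longrightarrow> s \<in> U \<Longrightarrow> ((\<lambda>s. f x s) has_real_derivative ft x s) (at s)"
    and integrable: "\<And>s. s \<in> U \<Longrightarrow> (\<lambda>x. f x s) integrable_on {a..b}"
    and cont: "continuous_on ({a..b} \<times> U) (\<lambda>p. ft (fst p) (snd p))"
  shows "((\<lambda>s. integral {a..b} (\<lambda>x. f x s)) has_real_derivative integral {a..b} (\<lambda>x. ft x t)) (at t)"
proof -
  have "continuous_on (U \<times> cbox a b) (\<lambda>p. (\<lambda>q. ft (fst q) (snd q)) (snd p, fst p))"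
    by (rule continuous_on_compose2[OF cont]) (auto intro!: continuous_intros simp: cbox_interval)
  then have "((\<lambda>s. integral (cbox a b) (\<lambda>x. f x s)) has_real_derivative integral (cbox a b) (\<lambda>x. ft x t))
      (at t within U)"
    using deriv integrable U
    by (intro leibniz_rule_field_derivative) (auto intro: has_field_derivative_at_within simp: split_beta)
  then show ?thesis
    using at_within_open[OF \<open>t \<in> U\<close> \<open>open U\<close>] by simp
qed

lemma integrable_on_slice:
  fixes f :: "real \<Rightarrow> real \<Rightarrow> real"
  assumes "continuous_on ({a..b} \<times> U) (\<lambda>p. f (fst p) (snd p))" and "t \<in> U"
  shows "(\<lambda>x. f x t) integrable_on {a..b}"
proof -
  have "continuous_on {a..b} (\<lambda>x. (\<lambda>p. f (fst p) (snd p)) (x, t))"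
    by (rule continuous_on_compose2[OF assms(1)]) (use assms(2) in \<open>auto intro!: continuous_intros\<close>)
  then show ?thesis
    by (simp add: integrable_continuous_interval)
qed

lemma open_convex_ereal_bounded:
  fixes c :: real and T :: ereal
  shows "open {t. c < t \<and> ereal t < T}" and "convex {t. c < t \<and> ereal t < T}"
proof -
  have "open {t. c < t \<and> ereal t < T} \<and> convex {t. c < t \<and> ereal t < T}"
  proof (cases T)
    case (real T')
    then have "{t. c < t \<and> ereal t < T} = {c<..<T'}" by auto
    then show ?thesis by simp
  next
    case PInf
    then have "{t. c < t \<and> ereal t < T} = {c<..}" by auto
    then show ?thesis by simp
  next
    case MInf
    then show ?thesis by simp
  qed
  then show "open {t. c < t \<and> ereal t < T}" and "convex {t. c < t \<and> ereal t < T}"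
    by simp_all
qed

lemma C21_has_derivative:
  assumes "C21 al be I f fx fxx ft" and "x \<in> {al..be}" and "t \<in> I"
  shows "((\<lambda>y. f y t) has_real_derivative fx x t) (at x within {al..be})"
    and "((\<lambda>y. fx y t) has_real_derivative fxx x t) (at x within {al..be})"
    and "((\<lambda>s. f x s) has_real_derivative ft x t) (at t)"
  using assms by (auto simp: C21_def)

lemma C21_continuous:
  assumes "C21 al be I f fx fxx ft"
  shows "continuous_on ({al..be} \<times> I) (\<lambda>p. f (fst p) (snd p))"
    and "continuous_on ({al..be} \<times> I) (\<lambda>p. fx (fst p) (snd p))"
    and "continuous_on ({al..be} \<times> I) (\<lambda>p. fxx (fst p) (snd p))"
    and "continuous_on ({al..be} \<times> I) (\<lambda>p. ft (fst p) (snd p))"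
  using assms by (auto simp: C21_def)

lemma energy_flux_identity:
  fixes w p z ut1 y \<theta>t g g1 g2 q r a D :: real
  assumes "g + D \<noteq> 0" and "y = g1 * q * w + g * p" and "\<theta>t = D * r + g * ut1\<^sup>2"
  shows "(2 * w * z * (g + D) - w\<^sup>2 * (g1 * \<theta>t)) / (g + D)\<^sup>2
      - ((z - a * ut1) * (2 * w / (g + D)) + y * (2 * p / (g + D) - 2 * w * (g1 * q) / (g + D)\<^sup>2)
         - D * (r * (w\<^sup>2 * g1 / (g + D)\<^sup>2) + q * (2 * w * p * g1 / (g + D)\<^sup>2
                + w\<^sup>2 * (g2 * q) / (g + D)\<^sup>2 - 2 * w\<^sup>2 * g1 * (g1 * q) / (g + D) ^ 3)))
    = 2 * a * ut1 * w / (g + D) - 2 * g * p\<^sup>2 / (g + D)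
      + q\<^sup>2 * w\<^sup>2 * (2 * g * g1\<^sup>2 + D * (g + D) * g2) / (g + D) ^ 3 - g * g1 * w\<^sup>2 * ut1\<^sup>2 / (g + D)\<^sup>2"
proof -
  define k where "k = g + D"
  have g: "g = k - D" and "k \<noteq> 0"
    using assms(1) by (simp_all add: k_def)
  show ?thesis
    using \<open>k \<noteq> 0\<close> unfolding assms(2,3) g by (simp add: field_simps power2_eq_square power3_eq_cube)
qed

lemma energy_flux_bound:
  fixes w p ut1 ux g g1 g2 q a D g0 \<eta> :: real
  assumes ut1: "ut1 = w - a * ux"
    and "0 < g0" "g0 \<le> g" "0 \<le> g1" and G2: "D * (g + D) * g2 + 2 * g * g1\<^sup>2 \<le> 0"
    and "0 < D" "0 < a" "0 < \<eta>"
  shows "2 * a * ut1 * w / (g + D) - 2 * g * p\<^sup>2 / (g + D)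
      + q\<^sup>2 * w\<^sup>2 * (2 * g * g1\<^sup>2 + D * (g + D) * g2) / (g + D) ^ 3 - g * g1 * w\<^sup>2 * ut1\<^sup>2 / (g + D)\<^sup>2
    \<le> (2 + \<eta>) * a * (w\<^sup>2 / (g + D)) + a ^ 3 / (\<eta> * D) * ux\<^sup>2 - 2 * g0 / (g0 + D) * p\<^sup>2"
proof -
  define k where "k = g + D"
  have "0 < k" "D \<le> k" using assms by (auto simp: k_def)
  have "q\<^sup>2 * w\<^sup>2 * (2 * g * g1\<^sup>2 + D * k * g2) / k ^ 3 \<le> 0"
    using G2 \<open>0 < k\<close> by (intro divide_nonpos_pos mult_nonneg_nonpos) (auto simp: k_def algebra_simps)
  moreover have "0 \<le> g * g1 * w\<^sup>2 * ut1\<^sup>2 / k\<^sup>2"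
    using assms by simp
  moreover have "2 * g0 / (g0 + D) * p\<^sup>2 \<le> 2 * g * p\<^sup>2 / k"
  proof -
    have "g0 / (g0 + D) \<le> g / k"
      using assms by (simp add: k_def field_simps)
    then have "g0 / (g0 + D) * (2 * p\<^sup>2) \<le> g / k * (2 * p\<^sup>2)"
      by (rule mult_right_mono) simp
    then show ?thesis
      by (simp add: ac_simps)
  qed
  moreover have "2 * a * ut1 * w / k \<le> (2 + \<eta>) * a * (w\<^sup>2 / k) + a ^ 3 / (\<eta> * D) * ux\<^sup>2"
  proof -
    \<comment> \<open>Young's inequality for the cross term \<open>- 2 a\<^sup>2 ux w / k\<close> hidden in \<open>2 a ut1 w / k\<close>\<close>
    have "(2 + \<eta>) * a * (w\<^sup>2 / k) + a ^ 3 / (\<eta> * k) * ux\<^sup>2 - 2 * a * ut1 * w / k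
        = a / (\<eta> * k) * (\<eta> * w + a * ux)\<^sup>2"
      using assms \<open>0 < k\<close> unfolding ut1 by (simp add: field_simps power2_eq_square power3_eq_cube)
    moreover have "0 \<le> a / (\<eta> * k) * (\<eta> * w + a * ux)\<^sup>2"
      using assms \<open>0 < k\<close> by simp
    ultimately have "2 * a * ut1 * w / k \<le> (2 + \<eta>) * a * (w\<^sup>2 / k) + a ^ 3 / (\<eta> * k) * ux\<^sup>2"
      by linarith
    moreover have "a ^ 3 / (\<eta> * k) * ux\<^sup>2 \<le> a ^ 3 / (\<eta> * D) * ux\<^sup>2"
      using assms \<open>D \<le> k\<close> by (intro mult_right_mono divide_left_mono mult_left_mono) auto
    ultimately show ?thesis by linarith
  qed
  ultimately show ?thesis
    unfolding k_def[symmetric] by (simp add: diff_divide_distrib add_divide_distrib)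
qed

locale thermoviscoelastic_solution =
  fixes al be a D :: real
    and \<gamma> \<gamma>' \<gamma>'' :: "real \<Rightarrow> real"
    and I :: "real set"
    and u ux uxx ut utx utxx utt \<Theta> \<Theta>x \<Theta>xx \<Theta>t vxt :: "real \<Rightarrow> real \<Rightarrow> real"
  assumes interval: "al < be"
    and a_pos: "0 < a" and D_pos: "0 < D"
    and I_open: "open I" and I_convex: "convex I"
    and g1_d1: "\<And>s. 0 \<le> s \<Longrightarrow> (\<gamma> has_real_derivative \<gamma>' s) (at s within {0..})"
    and g1_d2: "\<And>s. 0 \<le> s \<Longrightarrow> (\<gamma>' has_real_derivative \<gamma>'' s) (at s within {0..})"
    and g1_pos: "\<And>s. 0 \<le> s \<Longrightarrow> 0 < \<gamma> s"
    and g1_mono: "\<And>s. 0 \<le> s \<Longrightarrow> 0 \<le> \<gamma>' s"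
    and g2: "\<And>s. 0 \<le> s \<Longrightarrow> D * (\<gamma> s + D) * \<gamma>'' s + 2 * \<gamma> s * (\<gamma>' s)\<^sup>2 \<le> 0"
    and reg_u: "C21 al be I u ux uxx ut"
    and reg_ut: "C21 al be I ut utx utxx utt"
    and reg_Theta: "C21 al be I \<Theta> \<Theta>x \<Theta>xx \<Theta>t"
    and reg_vxt_t: "\<And>x t. x \<in> {al..be} \<Longrightarrow> t \<in> I \<Longrightarrow>
        ((\<lambda>s. utx x s + a * ux x s) has_real_derivative vxt x t) (at t)"
    and reg_vxt_x: "\<And>x t. x \<in> {al..be} \<Longrightarrow> t \<in> I \<Longrightarrow>
        ((\<lambda>y. utt y t + a * ut y t) has_real_derivative vxt x t) (at x within {al..be})"
    and reg_vxt_c: "continuous_on ({al..be} \<times> I) (\<lambda>p. vxt (fst p) (snd p))"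
    and Theta_nonneg: "\<And>x t. x \<in> {al..be} \<Longrightarrow> t \<in> I \<Longrightarrow> 0 \<le> \<Theta> x t"
    and eq_u: "\<And>x t. x \<in> {al<..<be} \<Longrightarrow> t \<in> I \<Longrightarrow>
        utt x t = deriv (\<lambda>y. \<gamma> (\<Theta> y t) * utx y t) x + a * deriv (\<lambda>y. \<gamma> (\<Theta> y t) * ux y t) x"
    and eq_Theta: "\<And>x t. x \<in> {al<..<be} \<Longrightarrow> t \<in> I \<Longrightarrow>
        \<Theta>t x t = D * \<Theta>xx x t + \<gamma> (\<Theta> x t) * (utx x t)\<^sup>2"
    and bc_u: "\<And>t. t \<in> I \<Longrightarrow> ux al t = 0 \<and> ux be t = 0"
    and bc_ut: "\<And>t. t \<in> I \<Longrightarrow> utx al t = 0 \<and> utx be t = 0"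
    and bc_Theta: "\<And>t. t \<in> I \<Longrightarrow> \<Theta>x al t = 0 \<and> \<Theta>x be t = 0"
begin

abbreviation vx :: "real \<Rightarrow> real \<Rightarrow> real" where
  "vx x s \<equiv> utx x s + a * ux x s"

abbreviation vxx :: "real \<Rightarrow> real \<Rightarrow> real" where
  "vxx x s \<equiv> utxx x s + a * uxx x s"

abbreviation \<kappa> :: "real \<Rightarrow> real \<Rightarrow> real" where
  "\<kappa> x s \<equiv> \<gamma> (\<Theta> x s) + D"

abbreviation energy_density_t :: "real \<Rightarrow> real \<Rightarrow> real" where
  "energy_density_t x s \<equiv>
     (2 * vx x s * vxt x s * \<kappa> x s - (vx x s)\<^sup>2 * (\<gamma>' (\<Theta> x s) * \<Theta>t x s)) / (\<kappa> x s)\<^sup>2"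

text \<open>The boundary term of both integrations by parts: \<open>v\<^sub>x\<^sub>t = (u\<^sub>t\<^sub>t + a u\<^sub>t)\<^sub>x\<close>
  against \<open>2 v\<^sub>x / \<kappa>\<close>, and \<open>D \<Theta>\<^sub>x\<^sub>x\<close> against \<open>v\<^sub>x\<^sup>2 \<gamma>'(\<Theta>) / \<kappa>\<^sup>2\<close>.\<close>

abbreviation flux :: "real \<Rightarrow> real \<Rightarrow> real" where
  "flux x s \<equiv> utt x s * (2 * vx x s / \<kappa> x s) - D * (\<Theta>x x s * ((vx x s)\<^sup>2 * \<gamma>' (\<Theta> x s) / (\<kappa> x s)\<^sup>2))"

abbreviation flux_x :: "real \<Rightarrow> real \<Rightarrow> real" where
  "flux_x x s \<equiv> (vxt x s - a * utx x s) * (2 * vx x s / \<kappa> x s)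
     + utt x s * (2 * vxx x s / \<kappa> x s - 2 * vx x s * (\<gamma>' (\<Theta> x s) * \<Theta>x x s) / (\<kappa> x s)\<^sup>2)
     - D * (\<Theta>xx x s * ((vx x s)\<^sup>2 * \<gamma>' (\<Theta> x s) / (\<kappa> x s)\<^sup>2)
            + \<Theta>x x s * (2 * vx x s * vxx x s * \<gamma>' (\<Theta> x s) / (\<kappa> x s)\<^sup>2
                + (vx x s)\<^sup>2 * (\<gamma>'' (\<Theta> x s) * \<Theta>x x s) / (\<kappa> x s)\<^sup>2
                - 2 * (vx x s)\<^sup>2 * \<gamma>' (\<Theta> x s) * (\<gamma>' (\<Theta> x s) * \<Theta>x x s) / (\<kappa> x s) ^ 3))"

lemma kappa_pos:
  assumes "x \<in> {al..be}" and "t \<in> I"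
  shows "0 < \<kappa> x t"
  using assms by (intro add_pos_pos g1_pos Theta_nonneg D_pos)

lemma comp_Theta_has_derivative_x:
  assumes h: "\<And>\<sigma>. 0 \<le> \<sigma> \<Longrightarrow> (h has_real_derivative h' \<sigma>) (at \<sigma> within {0..})"
    and x: "x \<in> {al..be}" and t: "t \<in> I"
  shows "((\<lambda>y. h (\<Theta> y t)) has_real_derivative h' (\<Theta> x t) * \<Theta>x x t) (at x within {al..be})"
proof (rule DERIV_chain_within_subset[where g="\<lambda>y. \<Theta> y t" and T="{0..}"])
  show "(h has_real_derivative h' (\<Theta> x t)) (at (\<Theta> x t) within {0..})"
    by (rule h[OF Theta_nonneg[OF x t]])
  show "((\<lambda>y. \<Theta> y t) has_real_derivative \<Theta>x x t) (at x within {al..be})"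
    using reg_Theta x t by (rule C21_has_derivative(1))
  show "(\<lambda>y. \<Theta> y t) ` {al..be} \<subseteq> {0..}"
    using Theta_nonneg t by auto
qed

lemma comp_Theta_has_derivative_t:
  assumes h: "\<And>\<sigma>. 0 \<le> \<sigma> \<Longrightarrow> (h has_real_derivative h' \<sigma>) (at \<sigma> within {0..})"
    and x: "x \<in> {al..be}" and t: "t \<in> I"
  shows "((\<lambda>s. h (\<Theta> x s)) has_real_derivative h' (\<Theta> x t) * \<Theta>t x t) (at t)"
proof -
  have "((\<lambda>s. h (\<Theta> x s)) has_real_derivative h' (\<Theta> x t) * \<Theta>t x t) (at t within I)"
  proof (rule DERIV_chain_within_subset[where g="\<lambda>s. \<Theta> x s" and T="{0..}"])
    show "(h has_real_derivative h' (\<Theta> x t)) (at (\<Theta> x t) within {0..})"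
      by (rule h[OF Theta_nonneg[OF x t]])
    show "((\<lambda>s. \<Theta> x s) has_real_derivative \<Theta>t x t) (at t within I)"
      using C21_has_derivative(3)[OF reg_Theta x t] by (rule has_field_derivative_at_within)
    show "(\<lambda>s. \<Theta> x s) ` I \<subseteq> {0..}"
      using Theta_nonneg x by auto
  qed
  then show ?thesis
    using at_within_open[OF t I_open] by simp
qed

lemma comp_Theta_continuous:
  assumes "\<And>\<sigma>. 0 \<le> \<sigma> \<Longrightarrow> (h has_real_derivative h' \<sigma>) (at \<sigma> within {0..})"
  shows "continuous_on ({al..be} \<times> I) (\<lambda>p. h (\<Theta> (fst p) (snd p)))"
proof (rule continuous_on_compose2[of "{0..}" h])
  show "continuous_on {0..} h"
    using assms by (intro DERIV_continuous_on) auto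
  show "continuous_on ({al..be} \<times> I) (\<lambda>p. \<Theta> (fst p) (snd p))"
    using reg_Theta by (rule C21_continuous(1))
  show "(\<lambda>p. \<Theta> (fst p) (snd p)) ` ({al..be} \<times> I) \<subseteq> {0..}"
    using Theta_nonneg by auto
qed

lemmas continuous_solution = C21_continuous[OF reg_u] C21_continuous[OF reg_ut]
  C21_continuous[OF reg_Theta] reg_vxt_c comp_Theta_continuous[OF g1_d1] comp_Theta_continuous[OF g1_d2]

lemma energy_has_derivative:
  assumes "t \<in> I"
  shows "((\<lambda>s. integral {al..be} (\<lambda>x. (vx x s)\<^sup>2 / \<kappa> x s)) has_real_derivative
      integral {al..be} (\<lambda>x. energy_density_t x t)) (at t)"
proof (rule leibniz_rule_real_derivative_open[OF I_open I_convex assms])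
  fix x s assume "x \<in> {al..be}" "s \<in> I"
  then have "((\<lambda>s. \<kappa> x s) has_real_derivative \<gamma>' (\<Theta> x s) * \<Theta>t x s + 0) (at s)"
    by (intro DERIV_add comp_Theta_has_derivative_t[OF g1_d1] DERIV_const)
  moreover have "\<kappa> x s \<noteq> 0"
    using kappa_pos \<open>x \<in> {al..be}\<close> \<open>s \<in> I\<close> by (simp add: less_imp_neq[symmetric])
  ultimately show "((\<lambda>s. (vx x s)\<^sup>2 / \<kappa> x s) has_real_derivative energy_density_t x s) (at s)"
    using reg_vxt_t \<open>x \<in> {al..be}\<close> \<open>s \<in> I\<close>
    by (intro DERIV_cong[OF DERIV_divide[OF DERIV_power]]) (auto simp: power2_eq_square)
next
  show "(\<lambda>x. (vx x s)\<^sup>2 / \<kappa> x s) integrable_on {al..be}" if "s \<in> I" for s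
    using that kappa_pos
    by (intro integrable_on_slice[where U=I] continuous_intros continuous_solution)
      (auto simp: less_imp_neq[symmetric])
  show "continuous_on ({al..be} \<times> I) (\<lambda>p. energy_density_t (fst p) (snd p))"
    using kappa_pos
    by (intro continuous_intros continuous_solution) (auto simp: less_imp_neq[symmetric])
qed

lemma utt_has_derivative_x:
  assumes "x \<in> {al..be}" and "t \<in> I"
  shows "((\<lambda>y. utt y t) has_real_derivative vxt x t - a * utx x t) (at x within {al..be})"
  using DERIV_diff[OF reg_vxt_x[OF assms] DERIV_cmult[OF C21_has_derivative(1)[OF reg_ut assms], of a]]
  by simp

lemma flux_has_derivative:
  assumes x: "x \<in> {al..be}" and t: "t \<in> I"
  shows "((\<lambda>y. flux y t) has_real_derivative flux_x x t) (at x within {al..be})"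
proof -
  define Y W K G1 Q where "Y = (\<lambda>y. utt y t)" and "W = (\<lambda>y. vx y t)" and "K = (\<lambda>y. \<kappa> y t)"
    and "G1 = (\<lambda>y. \<gamma>' (\<Theta> y t))" and "Q = (\<lambda>y. \<Theta>x y t)"
  have dY: "(Y has_real_derivative vxt x t - a * utx x t) (at x within {al..be})"
    unfolding Y_def using x t by (rule utt_has_derivative_x)
  have dW: "(W has_real_derivative vxx x t) (at x within {al..be})"
    unfolding W_def using x t
    by (intro DERIV_add DERIV_cmult C21_has_derivative(2)[OF reg_ut] C21_has_derivative(2)[OF reg_u])
  have dK: "(K has_real_derivative \<gamma>' (\<Theta> x t) * \<Theta>x x t) (at x within {al..be})"
    unfolding K_def using DERIV_add[OF comp_Theta_has_derivative_x[OF g1_d1 x t] DERIV_const] by simp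
  have dG1: "(G1 has_real_derivative \<gamma>'' (\<Theta> x t) * \<Theta>x x t) (at x within {al..be})"
    unfolding G1_def using g1_d2 x t by (rule comp_Theta_has_derivative_x)
  have dQ: "(Q has_real_derivative \<Theta>xx x t) (at x within {al..be})"
    unfolding Q_def using reg_Theta x t by (rule C21_has_derivative(2))
  have K: "K x \<noteq> 0" and K2: "(K x)\<^sup>2 \<noteq> 0"
    using kappa_pos[OF x t] by (simp_all add: K_def)
  have "((\<lambda>y. Y y * (2 * W y / K y) - D * (Q y * ((W y)\<^sup>2 * G1 y / (K y)\<^sup>2))) has_real_derivative
      (vxt x t - a * utx x t) * (2 * W x / K x)
      + Y x * (2 * vxx x t / K x - 2 * W x * (\<gamma>' (\<Theta> x t) * \<Theta>x x t) / (K x)\<^sup>2)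
      - D * (\<Theta>xx x t * ((W x)\<^sup>2 * G1 x / (K x)\<^sup>2)
             + Q x * (2 * W x * vxx x t * G1 x / (K x)\<^sup>2
                 + (W x)\<^sup>2 * (\<gamma>'' (\<Theta> x t) * \<Theta>x x t) / (K x)\<^sup>2
                 - 2 * (W x)\<^sup>2 * G1 x * (\<gamma>' (\<Theta> x t) * \<Theta>x x t) / (K x) ^ 3)))
      (at x within {al..be})"
    by (rule DERIV_cong[OF DERIV_diff[OF DERIV_mult[OF dY DERIV_divide[OF DERIV_cmult[OF dW] dK K]]
          DERIV_cmult[OF DERIV_mult[OF dQ DERIV_divide[OF DERIV_mult[OF DERIV_power[OF dW] dG1]
          DERIV_power[OF dK] K2]]]]])
      (use K in \<open>simp add: field_simps power2_eq_square power3_eq_cube\<close>)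
  then show ?thesis
    by (simp add: Y_def W_def K_def G1_def Q_def)
qed

lemma flux_vanishes_at_boundary:
  assumes "t \<in> I"
  shows "flux al t = 0" and "flux be t = 0"
  using bc_u[OF assms] bc_ut[OF assms] bc_Theta[OF assms] by simp_all

lemma deriv_gamma_Theta_mult:
  assumes x: "x \<in> {al<..<be}" and t: "t \<in> I"
    and f: "(f has_real_derivative f') (at x within {al..be})"
  shows "deriv (\<lambda>y. \<gamma> (\<Theta> y t) * f y) x = \<gamma>' (\<Theta> x t) * \<Theta>x x t * f x + \<gamma> (\<Theta> x t) * f'"
proof (rule DERIV_imp_deriv)
  have "x \<in> {al..be}" and "at x within {al..be} = at x"
    using x by (auto intro: at_within_interior)
  then show "((\<lambda>y. \<gamma> (\<Theta> y t) * f y) has_real_derivative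
      \<gamma>' (\<Theta> x t) * \<Theta>x x t * f x + \<gamma> (\<Theta> x t) * f') (at x)"
    using DERIV_mult[OF comp_Theta_has_derivative_x[OF g1_d1 _ t] f] by (simp add: mult.commute)
qed

lemma eq_u_expanded:
  assumes x: "x \<in> {al<..<be}" and t: "t \<in> I"
  shows "utt x t = \<gamma>' (\<Theta> x t) * \<Theta>x x t * vx x t + \<gamma> (\<Theta> x t) * vxx x t"
proof -
  have "x \<in> {al..be}"
    using x by auto
  then show ?thesis
    using eq_u[OF x t] deriv_gamma_Theta_mult[OF x t C21_has_derivative(2)[OF reg_ut _ t]]
      deriv_gamma_Theta_mult[OF x t C21_has_derivative(2)[OF reg_u _ t]]
    by (simp add: algebra_simps)
qed

lemma energy_density_t_minus_flux_x_le:
  assumes x: "x \<in> {al<..<be}" and t: "t \<in> I" and "0 < \<eta>"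
  shows "energy_density_t x t - flux_x x t \<le> (2 + \<eta>) * a * ((vx x t)\<^sup>2 / \<kappa> x t)
    + a ^ 3 / (\<eta> * D) * (ux x t)\<^sup>2 - 2 * \<gamma> 0 / (\<gamma> 0 + D) * (vxx x t)\<^sup>2"
proof -
  have "x \<in> {al..be}"
    using x by auto
  then have \<Theta>: "0 \<le> \<Theta> x t"
    using t by (rule Theta_nonneg)
  have "energy_density_t x t - flux_x x t
      = 2 * a * utx x t * vx x t / \<kappa> x t - 2 * \<gamma> (\<Theta> x t) * (vxx x t)\<^sup>2 / \<kappa> x t
        + (\<Theta>x x t)\<^sup>2 * (vx x t)\<^sup>2 * (2 * \<gamma> (\<Theta> x t) * (\<gamma>' (\<Theta> x t))\<^sup>2
           + D * \<kappa> x t * \<gamma>'' (\<Theta> x t)) / (\<kappa> x t) ^ 3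
        - \<gamma> (\<Theta> x t) * \<gamma>' (\<Theta> x t) * (vx x t)\<^sup>2 * (utx x t)\<^sup>2 / (\<kappa> x t)\<^sup>2"
    using kappa_pos[OF \<open>x \<in> {al..be}\<close> t] eq_u_expanded[OF x t] eq_Theta[OF x t]
    by (intro energy_flux_identity) auto
  also have "\<dots> \<le> (2 + \<eta>) * a * ((vx x t)\<^sup>2 / \<kappa> x t)
    + a ^ 3 / (\<eta> * D) * (ux x t)\<^sup>2 - 2 * \<gamma> 0 / (\<gamma> 0 + D) * (vxx x t)\<^sup>2"
    using DERIV_nonneg_imp_increasing_atLeast[OF g1_d1 g1_mono \<Theta>] g1_pos g1_mono[OF \<Theta>] g2[OF \<Theta>]
      D_pos a_pos \<open>0 < \<eta>\<close>
    by (intro energy_flux_bound) auto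
  finally show ?thesis .
qed

lemma integral_energy_density_t_le:
  assumes t: "t \<in> I" and "0 < \<eta>"
  shows "integral {al..be} (\<lambda>x. energy_density_t x t)
    \<le> (2 + \<eta>) * a * integral {al..be} (\<lambda>x. (vx x t)\<^sup>2 / \<kappa> x t)
      + a ^ 3 / (\<eta> * D) * integral {al..be} (\<lambda>x. (ux x t)\<^sup>2)
      - 2 * \<gamma> 0 / (\<gamma> 0 + D) * integral {al..be} (\<lambda>x. (vxx x t)\<^sup>2)"
proof -
  have "\<forall>p\<in>{al..be} \<times> I. \<kappa> (fst p) (snd p) \<noteq> 0"
    using kappa_pos by (auto simp: less_imp_neq[symmetric])
  then have integrable: "(\<lambda>x. energy_density_t x t) integrable_on {al..be}"
    "(\<lambda>x. (vx x t)\<^sup>2 / \<kappa> x t) integrable_on {al..be}"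
    "(\<lambda>x. (ux x t)\<^sup>2) integrable_on {al..be}"
    "(\<lambda>x. (vxx x t)\<^sup>2) integrable_on {al..be}"
    by (intro integrable_on_slice[OF _ t] continuous_intros continuous_solution; simp)+
  define R where "R x = (2 + \<eta>) * a * ((vx x t)\<^sup>2 / \<kappa> x t) + a ^ 3 / (\<eta> * D) * (ux x t)\<^sup>2
    - 2 * \<gamma> 0 / (\<gamma> 0 + D) * (vxx x t)\<^sup>2" for x
  have R: "(R has_integral (2 + \<eta>) * a * integral {al..be} (\<lambda>x. (vx x t)\<^sup>2 / \<kappa> x t)
      + a ^ 3 / (\<eta> * D) * integral {al..be} (\<lambda>x. (ux x t)\<^sup>2)
      - 2 * \<gamma> 0 / (\<gamma> 0 + D) * integral {al..be} (\<lambda>x. (vxx x t)\<^sup>2)) {al..be}"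
    unfolding R_def using integrable(2-4)
    by (intro has_integral_diff has_integral_add has_integral_mult_right integrable_integral)
  have "integral {al..be} (\<lambda>x. energy_density_t x t) \<le> integral {al..be} R"
  proof (rule integral_le_by_vanishing_flux[where F="\<lambda>y. flux y t" and F'="\<lambda>y. flux_x y t"])
    show "al \<le> be"
      using interval by simp
    show "((\<lambda>y. flux y t) has_real_derivative flux_x x t) (at x within {al..be})"
      if "x \<in> {al..be}" for x
      using that t by (rule flux_has_derivative)
    show "flux al t = 0" and "flux be t = 0"
      using t by (rule flux_vanishes_at_boundary)+
    show "(\<lambda>x. energy_density_t x t) integrable_on {al..be}" and "R integrable_on {al..be}"
      using integrable(1) R by blast+
    show "energy_density_t x t - flux_x x t \<le> R x" if "x \<in> {al<..<be}" for x
      unfolding R_def using that t \<open>0 < \<eta>\<close> by (rule energy_density_t_minus_flux_x_le)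
  qed
  also have "\<dots> = (2 + \<eta>) * a * integral {al..be} (\<lambda>x. (vx x t)\<^sup>2 / \<kappa> x t)
      + a ^ 3 / (\<eta> * D) * integral {al..be} (\<lambda>x. (ux x t)\<^sup>2)
      - 2 * \<gamma> 0 / (\<gamma> 0 + D) * integral {al..be} (\<lambda>x. (vxx x t)\<^sup>2)"
    using R by (rule integral_unique)
  finally show ?thesis .
qed

lemma energy_inequality:
  assumes t: "t \<in> I" and "0 < \<eta>"
  shows "(\<lambda>s. integral {al..be} (\<lambda>x. (vx x s)\<^sup>2 / \<kappa> x s)) differentiable (at t) \<and>
     deriv (\<lambda>s. integral {al..be} (\<lambda>x. (vx x s)\<^sup>2 / \<kappa> x s)) t
       + 2 * \<gamma> 0 / (\<gamma> 0 + D) * integral {al..be} (\<lambda>x. (vxx x t)\<^sup>2)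
     \<le> (2 + \<eta>) * a * integral {al..be} (\<lambda>x. (vx x t)\<^sup>2 / \<kappa> x t)
       + a ^ 3 / (\<eta> * D) * integral {al..be} (\<lambda>x. (ux x t)\<^sup>2)"
  using energy_has_derivative[OF t] DERIV_imp_deriv[OF energy_has_derivative[OF t]]
    integral_energy_density_t_le[OF assms]
  unfolding real_differentiable_def by auto

end

theorem lemma2p2:
  fixes al be a D :: real
    and \<gamma> \<gamma>' \<gamma>'' :: "real \<Rightarrow> real"
    and Tmax :: ereal
    and u ux uxx ut utx utxx utt \<Theta> \<Theta>x \<Theta>xx \<Theta>t vxt :: "real \<Rightarrow> real \<Rightarrow> real"
  defines "I \<equiv> {t::real. 0 < t \<and> ereal t < Tmax}"
  assumes interval: "al < be"
    and a_pos: "0 < a" and D_pos: "0 < D"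
    and Tmax_pos: "0 < Tmax"
    \<comment> \<open>(G1): gamma in C^2([0,oo)), gamma > 0, gamma' >= 0\<close>
    and g1_d1: "\<And>s. 0 \<le> s \<Longrightarrow> (\<gamma> has_real_derivative \<gamma>' s) (at s within {0..})"
    and g1_d2: "\<And>s. 0 \<le> s \<Longrightarrow> (\<gamma>' has_real_derivative \<gamma>'' s) (at s within {0..})"
    and g1_c2: "continuous_on {0..} \<gamma>''"
    and g1_pos: "\<And>s. 0 \<le> s \<Longrightarrow> 0 < \<gamma> s"
    and g1_mono: "\<And>s. 0 \<le> s \<Longrightarrow> 0 \<le> \<gamma>' s"
    \<comment> \<open>(G2)\<close>
    and g2: "\<And>s. 0 \<le> s \<Longrightarrow> D * (\<gamma> s + D) * \<gamma>'' s + 2 * \<gamma> s * (\<gamma>' s)\<^sup>2 \<le> 0"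
    \<comment> \<open>regularity: u, u_t, Theta in C^{2,1}(closure Omega x (0,Tmax))\<close>
    and reg_u: "C21 al be I u ux uxx ut"
    and reg_ut: "C21 al be I ut utx utxx utt"
    and reg_Theta: "C21 al be I \<Theta> \<Theta>x \<Theta>xx \<Theta>t"
    \<comment> \<open>mixed derivative v_xt = (v_x)_t = (v_t)_x of v = u_t + a u exists and is continuous\<close>
    and reg_vxt_t: "\<And>x t. x \<in> {al..be} \<Longrightarrow> t \<in> I \<Longrightarrow>
        ((\<lambda>s. utx x s + a * ux x s) has_real_derivative vxt x t) (at t)"
    and reg_vxt_x: "\<And>x t. x \<in> {al..be} \<Longrightarrow> t \<in> I \<Longrightarrow>
        ((\<lambda>y. utt y t + a * ut y t) has_real_derivative vxt x t) (at x within {al..be})"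
    and reg_vxt_c: "continuous_on ({al..be} \<times> I) (\<lambda>p. vxt (fst p) (snd p))"
    \<comment> \<open>Theta >= 0\<close>
    and Theta_nonneg: "\<And>x t. x \<in> {al..be} \<Longrightarrow> t \<in> I \<Longrightarrow> 0 \<le> \<Theta> x t"
    \<comment> \<open>the PDE system in Omega x (0,Tmax)\<close>
    and eq_u: "\<And>x t. x \<in> {al<..<be} \<Longrightarrow> t \<in> I \<Longrightarrow>
        utt x t = deriv (\<lambda>y. \<gamma> (\<Theta> y t) * utx y t) x
                  + a * deriv (\<lambda>y. \<gamma> (\<Theta> y t) * ux y t) x"
    and eq_Theta: "\<And>x t. x \<in> {al<..<be} \<Longrightarrow> t \<in> I \<Longrightarrow>
        \<Theta>t x t = D * \<Theta>xx x t + \<gamma> (\<Theta> x t) * (utx x t)\<^sup>2"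
    \<comment> \<open>Neumann boundary conditions (u_x = Theta_x = 0, hence v_x = 0, on the boundary)\<close>
    and bc_u: "\<And>t. t \<in> I \<Longrightarrow> ux al t = 0 \<and> ux be t = 0"
    and bc_ut: "\<And>t. t \<in> I \<Longrightarrow> utx al t = 0 \<and> utx be t = 0"
    and bc_Theta: "\<And>t. t \<in> I \<Longrightarrow> \<Theta>x al t = 0 \<and> \<Theta>x be t = 0"
  shows "\<forall>\<eta>>0. \<forall>t\<in>I.
     (\<lambda>s. integral {al..be} (\<lambda>x. (utx x s + a * ux x s)\<^sup>2 / (\<gamma> (\<Theta> x s) + D)))
        differentiable (at t) \<and>
     deriv (\<lambda>s. integral {al..be} (\<lambda>x. (utx x s + a * ux x s)\<^sup>2 / (\<gamma> (\<Theta> x s) + D))) t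
       + 2 * \<gamma> 0 / (\<gamma> 0 + D) * integral {al..be} (\<lambda>x. (utxx x t + a * uxx x t)\<^sup>2)
     \<le> (2 + \<eta>) * a * integral {al..be} (\<lambda>x. (utx x t + a * ux x t)\<^sup>2 / (\<gamma> (\<Theta> x t) + D))
       + a ^ 3 / (\<eta> * D) * integral {al..be} (\<lambda>x. (ux x t)\<^sup>2)"
proof -
  have "open I" and "convex I"
    unfolding I_def by (rule open_convex_ereal_bounded)+
  interpret thermoviscoelastic_solution al be a D \<gamma> \<gamma>' \<gamma>'' I u ux uxx ut utx utxx utt \<Theta> \<Theta>x \<Theta>xx \<Theta>t vxt
    by unfold_locales (fact assms \<open>open I\<close> \<open>convex I\<close>)+
  show ?thesis
    using energy_inequality by blast
qed

end
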